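(* (Dual Orlicz-Urysohn inequality) Let $K\in\mathcal{S}_0$ be a star body about the origin in $\mathbb{R}^n$ and let $\phi:(0,\infty)\to(0,\infty)$ be continuous. If $F(t)=\phi(t^{1/n})$ is concave, then $$\widetilde{\omega}_\phi(K)\leq\widetilde{\omega}_\phi(B_K),$$ while if $F$ is convex, the inequality is reversed. If $F$ is strictly concave (or strictly convex, as appropriate), equality holds if and only if $K$ is an origin-symmetric Euclidean ball.
   Context: $B_2^n$ is the closed unit Euclidean ball of $\mathbb{R}^n$, $S^{n-1}$ the unit sphere, $\sigma$ the spherical measure, $|\cdot|$ volume, $\omega_n=|B_2^n|$. A compact set $K$ that contains the closed segment from the origin to each of its points has radial function $\rho_K(u)=\max\{\lambda:\lambda u\in K\}$, $u\in S^{n-1}$; $K$ is a star body about the origin ($K\in\mathcal{S}_0$) if $\rho_K$ is continuous and positive on $S^{n-1}$. $\mathrm{vrad}(K)=(|K|/\omega_n)^{1/n}$ and $B_K=\mathrm{vrad}(K)B_2^n$. The Orlicz $L_\phi$ mean radius of $K$ is $$\widetilde{\omega}_\phi(K)=\frac{1}{n\omega_n}\int_{S^{n-1}}\phi\big(\rho_K(u)\big)\,d\sigma(u).$$ An origin-symmetric Euclidean ball is $rB_2^n$ with $r>0$. *)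

theory Defs
  imports "HOL-Analysis.Analysis"
begin

text \<open>
  The library has no surface measure. The spherical (surface area) measure on the Borel sets of
  the unit sphere is defined as the cone measure
  \<open>\<sigma>(A) = n \<cdot> |{r u : 0 < r \<le> 1, u \<in> A}|\<close>, i.e. as \<open>n\<close> times the image of Lebesgue
  measure on the punctured unit ball under the radial projection. The lemmas below record this
  formula, the total mass \<open>n \<omega>\<^sub>n\<close> and invariance under orthogonal maps (where the sort
  constraint is inherited from the library's change-of-variables theorem).
\<close>

definition spherical_measure :: "(real ^ 'n) measure" where
  "spherical_measure =
     distr (scale_measure (of_nat CARD('n)) (restrict_space lborel (cball 0 1 - {0})))
       (restrict_space borel (sphere 0 1)) (\<lambda>x. x /\<^sub>R norm x)"

lemma space_spherical_measure: "space (spherical_measure :: (real ^ 'n) measure) = sphere 0 1"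
  by (simp add: spherical_measure_def space_restrict_space)

lemma sets_spherical_measure:
  "sets (spherical_measure :: (real ^ 'n) measure) = sets (restrict_space borel (sphere 0 1))"
  by (simp add: spherical_measure_def)

lemma measurable_radial_projection:
  "(\<lambda>x :: real ^ 'n. x /\<^sub>R norm x) \<in>
     scale_measure c (restrict_space lborel (cball 0 1 - {0})) \<rightarrow>\<^sub>M restrict_space borel (sphere 0 1)"
proof (rule measurable_restrict_space2)
  show "(\<lambda>x :: real ^ 'n. x /\<^sub>R norm x)
      \<in> space (scale_measure c (restrict_space lborel (cball 0 1 - {0}))) \<rightarrow> sphere 0 1"
    by (auto simp: space_scale_measure space_restrict_space)
  have "(\<lambda>x :: real ^ 'n. x /\<^sub>R norm x) \<in> borel_measurable (restrict_space lborel (cball 0 1 - {0}))"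
    by (rule measurable_restrict_space1) measurable
  then show "(\<lambda>x :: real ^ 'n. x /\<^sub>R norm x)
      \<in> borel_measurable (scale_measure c (restrict_space lborel (cball 0 1 - {0})))"
    by (simp cong: measurable_cong_sets add: measurable_def space_scale_measure)
qed

lemma emeasure_spherical_measure:
  fixes A :: "(real ^ 'n) set"
  assumes "A \<in> sets spherical_measure"
  shows "emeasure spherical_measure A =
    of_nat CARD('n) * emeasure lborel {r *\<^sub>R u | r u. 0 < r \<and> r \<le> 1 \<and> u \<in> A}"
proof -
  let ?B = "cball 0 1 - {0} :: (real ^ 'n) set"
  have A: "A \<in> sets (restrict_space borel (sphere 0 1))"
    using assms by (simp add: sets_spherical_measure)
  then have sub: "A \<subseteq> sphere 0 1"
    by (auto simp: sets_restrict_space)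
  have eq: "(\<lambda>x. x /\<^sub>R norm x) -` A \<inter> ?B = {r *\<^sub>R u | r u. 0 < r \<and> r \<le> 1 \<and> u \<in> A}"
  proof (intro equalityI subsetI)
    fix x assume x: "x \<in> (\<lambda>x. x /\<^sub>R norm x) -` A \<inter> ?B"
    then have "x = norm x *\<^sub>R (x /\<^sub>R norm x)" "0 < norm x" "norm x \<le> 1" "x /\<^sub>R norm x \<in> A"
      by auto
    then show "x \<in> {r *\<^sub>R u | r u. 0 < r \<and> r \<le> 1 \<and> u \<in> A}"
      by blast
  next
    fix x assume "x \<in> {r *\<^sub>R u | r u. 0 < r \<and> r \<le> 1 \<and> u \<in> A}"
    then obtain r u where x: "x = r *\<^sub>R u" "0 < r" "r \<le> 1" "u \<in> A"
      by blast
    then have "norm u = 1"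
      using sub by auto
    with x show "x \<in> (\<lambda>x. x /\<^sub>R norm x) -` A \<inter> ?B"
      by auto
  qed
  have "emeasure spherical_measure A = of_nat CARD('n) *
      emeasure (restrict_space lborel ?B) ((\<lambda>x. x /\<^sub>R norm x) -` A \<inter> ?B)"
    unfolding spherical_measure_def
    by (subst emeasure_distr[OF measurable_radial_projection A])
      (simp add: space_scale_measure space_restrict_space)
  also have "emeasure (restrict_space lborel ?B) ((\<lambda>x. x /\<^sub>R norm x) -` A \<inter> ?B) =
      emeasure lborel ((\<lambda>x. x /\<^sub>R norm x) -` A \<inter> ?B)"
    by (rule emeasure_restrict_space) auto
  finally show ?thesis
    by (simp add: eq)
qed

lemma emeasure_spherical_measure_sphere:
  "emeasure (spherical_measure :: (real ^ 'n) measure) (sphere 0 1) =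
     of_nat CARD('n) * emeasure lborel (cball 0 1 :: (real ^ 'n) set)"
proof -
  let ?C = "{r *\<^sub>R u | r u. 0 < r \<and> r \<le> 1 \<and> u \<in> sphere 0 1} :: (real ^ 'n) set"
  have "?C = cball 0 1 - {0}"
  proof (intro equalityI subsetI)
    fix x :: "real ^ 'n" assume "x \<in> cball 0 1 - {0}"
    then have "x = norm x *\<^sub>R (x /\<^sub>R norm x)" "0 < norm x" "norm x \<le> 1" "x /\<^sub>R norm x \<in> sphere 0 1"
      by auto
    then show "x \<in> ?C"
      by blast
  qed auto
  moreover have "emeasure lborel (cball 0 1 - {0} :: (real ^ 'n) set) = emeasure lborel (cball 0 1 :: (real ^ 'n) set)"
    by (subst emeasure_Diff) auto
  moreover have "sphere 0 1 \<in> sets (spherical_measure :: (real ^ 'n) measure)"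
    by (metis sets.top space_spherical_measure)
  ultimately show ?thesis
    by (simp only: emeasure_spherical_measure)
qed

lemma emeasure_spherical_measure_orthogonal_image:
  fixes A :: "(real ^ 'n::{finite,wellorder}) set" and f :: "real ^ 'n::{finite,wellorder} \<Rightarrow> real ^ 'n::{finite,wellorder}"
  assumes f: "orthogonal_transformation f" and A: "A \<in> sets spherical_measure"
  shows "emeasure spherical_measure (f ` A) = emeasure spherical_measure A"
proof -
  let ?C = "\<lambda>A :: (real ^ 'n::{finite,wellorder}) set. {r *\<^sub>R u | r u. 0 < r \<and> r \<le> 1 \<and> u \<in> A}"
  let ?p = "\<lambda>x :: real ^ 'n::{finite,wellorder}. x /\<^sub>R norm x"
  have lin: "linear f"
    using f by (rule orthogonal_transformation_linear)
  have inv: "orthogonal_transformation (inv f)"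
    using f by (rule orthogonal_transformation_inv)
  have bij: "bij f"
    using f by (rule orthogonal_transformation_bij)
  have contf: "f \<in> borel_measurable borel" "inv f \<in> borel_measurable borel"
    using lin inv by (auto intro!: borel_measurable_continuous_onI linear_continuous_on
        simp: linear_conv_bounded_linear[symmetric] orthogonal_transformation_linear)
  have AB: "A \<in> sets borel" "A \<subseteq> sphere 0 1"
    using A by (auto simp: sets_spherical_measure sets_restrict_space)
  have C_borel: "?C B \<in> sets borel" if "B \<in> sets borel" "B \<subseteq> sphere 0 1" for B
  proof -
    have "?C B = ?p -` B \<inter> (cball 0 1 - {0})"
    proof (intro equalityI subsetI)
      fix x assume "x \<in> ?p -` B \<inter> (cball 0 1 - {0})"
      then have "x = norm x *\<^sub>R (x /\<^sub>R norm x)" "0 < norm x" "norm x \<le> 1" "x /\<^sub>R norm x \<in> B"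
        by auto
      then show "x \<in> ?C B"
        by blast
    next
      fix x assume "x \<in> ?C B"
      then obtain r u where x: "x = r *\<^sub>R u" "0 < r" "r \<le> 1" "u \<in> B"
        by blast
      then have "norm u = 1"
        using that by auto
      with x show "x \<in> ?p -` B \<inter> (cball 0 1 - {0})"
        by auto
    qed
    moreover have "?p \<in> borel_measurable borel"
      by measurable
    then have "?p -` B \<in> sets borel"
      using measurable_sets[of ?p borel borel B] that by simp
    ultimately show ?thesis
      by auto
  qed
  have "f ` A = inv f -` A"
    using bij by (simp add: bij_vimage_eq_inv_image bij_imp_bij_inv inv_inv_eq)
  then have fA: "f ` A \<in> sets borel"
    using measurable_sets[OF contf(2), of A] AB by simp
  have fS: "f ` A \<subseteq> sphere 0 1"
    using AB f by (auto simp: orthogonal_transformation_norm)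
  have C_sub: "?C B \<subseteq> cball 0 1" if "B \<subseteq> sphere 0 1" for B
    using that by (auto simp: subset_iff)
  have C_lm: "?C B \<in> lmeasurable" if "B \<in> sets borel" "B \<subseteq> sphere 0 1" for B
    using C_borel[OF that] C_sub[OF that(2)]
    by (intro bounded_set_imp_lmeasurable) (auto intro: bounded_subset[OF bounded_cball])
  have "?C (f ` A) = f ` ?C A"
    using lin by (force simp: linear_cmul image_def)
  then have "measure lebesgue (?C (f ` A)) = measure lebesgue (?C A)"
    using measure_orthogonal_image[OF f C_lm[OF AB]] by simp
  then have "emeasure lebesgue (?C (f ` A)) = emeasure lebesgue (?C A)"
    using C_lm[OF AB] C_lm[OF fA fS] by (simp add: emeasure_eq_measure2 fmeasurableD2)
  then have "emeasure lborel (?C (f ` A)) = emeasure lborel (?C A)"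
    using C_borel[OF AB] C_borel[OF fA fS] by simp
  moreover have "f ` A \<in> sets spherical_measure"
    using fA fS by (auto simp: sets_spherical_measure sets_restrict_space)
  ultimately show ?thesis
    using A by (simp add: emeasure_spherical_measure)
qed

definition radial_function :: "(real ^ 'n) set \<Rightarrow> real ^ 'n \<Rightarrow> real" where
  "radial_function K u = (GREATEST l. l *\<^sub>R u \<in> K)"

text \<open>
  Nonemptiness makes the maximum in the radial function exist; it is implicit in
  \<open>\<rho>\<^sub>K\<close> being defined.
\<close>

definition star_body :: "(real ^ 'n) set \<Rightarrow> bool" where
  "star_body K \<longleftrightarrow>
     K \<noteq> {} \<and> compact K \<and> (\<forall>x\<in>K. closed_segment 0 x \<subseteq> K) \<and>
     continuous_on (sphere 0 1) (radial_function K) \<and>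
     (\<forall>u\<in>sphere 0 1. radial_function K u > 0)"

definition vrad :: "(real ^ 'n) set \<Rightarrow> real" where
  "vrad K = root CARD('n) (measure lborel K / measure lborel (cball 0 1 :: (real ^ 'n) set))"

definition vrad_ball :: "(real ^ 'n) set \<Rightarrow> (real ^ 'n) set" where
  "vrad_ball K = (\<lambda>x. vrad K *\<^sub>R x) ` cball 0 1"

definition orlicz_mean_radius :: "(real \<Rightarrow> real) \<Rightarrow> (real ^ 'n) set \<Rightarrow> real" where
  "orlicz_mean_radius \<phi> K =
     1 / (real CARD('n) * measure lborel (cball 0 1 :: (real ^ 'n) set)) *
     (LINT u|spherical_measure. \<phi> (radial_function K u))"

definition origin_symmetric_ball :: "(real ^ 'n) set \<Rightarrow> bool" where
  "origin_symmetric_ball K \<longleftrightarrow> (\<exists>r>0. K = (\<lambda>x. r *\<^sub>R x) ` cball 0 1)"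

definition strictly_convex_on :: "'a::real_vector set \<Rightarrow> ('a \<Rightarrow> real) \<Rightarrow> bool" where
  "strictly_convex_on S f \<longleftrightarrow> convex S \<and>
     (\<forall>x\<in>S. \<forall>y\<in>S. \<forall>u>0. \<forall>v>0. x \<noteq> y \<longrightarrow> u + v = 1 \<longrightarrow>
        f (u *\<^sub>R x + v *\<^sub>R y) < u * f x + v * f y)"

definition strictly_concave_on :: "'a::real_vector set \<Rightarrow> ('a \<Rightarrow> real) \<Rightarrow> bool" where
  "strictly_concave_on S f \<longleftrightarrow> strictly_convex_on S (\<lambda>x. - f x)"

end

theory Submission
  imports Defs
begin

text \<open>
  In polar coordinates \<open>n |K| = \<integral> \<rho>\<^sub>K\<^sup>n d\<sigma>\<close>, so \<open>vrad(K)\<^sup>n\<close> is the mean of \<open>\<rho>\<^sub>K\<^sup>n\<close> under the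
  normalised spherical measure. The mean radius of \<open>K\<close> is the mean of \<open>F(\<rho>\<^sub>K\<^sup>n)\<close>, and that of
  \<open>B\<^sub>K\<close> is \<open>F(vrad(K)\<^sup>n)\<close>, so the inequality is Jensen's. In the equality case \<open>\<rho>\<^sub>K\<close> is
  constant almost everywhere, hence everywhere by continuity, as \<open>\<sigma>\<close> charges every nonempty
  relatively open subset of the sphere. The polar formula is proved for simple functions on the
  sphere by scaling of sectors, and then by monotone convergence.
\<close>

section \<open>Polar coordinates: volumes of sectors and of radial subgraphs\<close>

lemma borel_set_spherical_measure:
  fixes A :: "(real ^ 'n) set"
  assumes "A \<in> sets spherical_measure"
  shows "A \<in> sets borel" "A \<subseteq> sphere 0 1"
  using assms by (auto simp: sets_spherical_measure sets_restrict_space)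

text \<open>The right-hand side is a preimage under the radial projection, a form suited to
  measurability and scaling arguments.\<close>

lemma spherical_sector_eq:
  fixes A :: "(real ^ 'n) set"
  assumes "A \<subseteq> sphere 0 1"
  shows "{r *\<^sub>R u | r u. 0 < r \<and> r \<le> 1 \<and> u \<in> A} = {x. x \<noteq> 0 \<and> norm x \<le> 1 \<and> x /\<^sub>R norm x \<in> A}"
proof (intro equalityI subsetI)
  fix x assume "x \<in> {x. x \<noteq> 0 \<and> norm x \<le> 1 \<and> x /\<^sub>R norm x \<in> A}"
  then have "x = norm x *\<^sub>R (x /\<^sub>R norm x)" "0 < norm x" "norm x \<le> 1" "x /\<^sub>R norm x \<in> A"
    by auto
  then show "x \<in> {r *\<^sub>R u | r u. 0 < r \<and> r \<le> 1 \<and> u \<in> A}"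
    by blast
next
  fix x assume "x \<in> {r *\<^sub>R u | r u. 0 < r \<and> r \<le> 1 \<and> u \<in> A}"
  then obtain r u where x: "x = r *\<^sub>R u" "0 < r" "r \<le> 1" "u \<in> A"
    by blast
  then have "norm u = 1"
    using assms by auto
  with x show "x \<in> {x. x \<noteq> 0 \<and> norm x \<le> 1 \<and> x /\<^sub>R norm x \<in> A}"
    by auto
qed

lemma emeasure_lborel_scaleR_vimage:
  fixes S :: "'a::euclidean_space set"
  assumes S: "S \<in> sets borel" and c: "c > 0"
  shows "emeasure lborel S = ennreal (c ^ DIM('a)) * emeasure lborel ((\<lambda>x. c *\<^sub>R x) -` S)"
proof -
  have "emeasure lborel S =
      emeasure (density (distr lborel borel (\<lambda>x::'a. 0 + c *\<^sub>R x)) (\<lambda>_. ennreal (\<bar>c\<bar> ^ DIM('a)))) S"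
    using c by (subst lborel_affine[of c 0]) auto
  also have "\<dots> = ennreal (c ^ DIM('a)) * emeasure (distr lborel borel (\<lambda>x::'a. 0 + c *\<^sub>R x)) S"
    using S c by (subst emeasure_density_const) auto
  also have "emeasure (distr lborel borel (\<lambda>x::'a. 0 + c *\<^sub>R x)) S = emeasure lborel ((\<lambda>x. c *\<^sub>R x) -` S)"
    using S by (subst emeasure_distr) auto
  finally show ?thesis .
qed

text \<open>Dilation by \<open>c\<close> carries the unit sector over \<open>A\<close> to the sector
  of radius \<open>c\<close> and multiplies volume by \<open>c ^ CARD('n)\<close>. The open sector
  may replace the closed one because the sphere of radius \<open>c\<close> is null.\<close>

lemma emeasure_spherical_sector:
  fixes A :: "(real ^ 'n) set"
  assumes A: "A \<in> sets spherical_measure" and c: "c \<ge> 0"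
  shows "of_nat CARD('n) * emeasure lborel {x. x \<noteq> 0 \<and> norm x < c \<and> x /\<^sub>R norm x \<in> A} =
    ennreal (c ^ CARD('n)) * emeasure spherical_measure A"
proof (cases "c = 0")
  case True
  \<comment> \<open>The sector is empty, and \<open>0 ^ CARD('n) = 0\<close> because the dimension
    is positive.\<close>
  then show ?thesis by (simp add: zero_power)
next
  case False
  then have c: "c > 0" using c by simp
  note [measurable] = borel_set_spherical_measure(1)[OF A]
  have null: "sphere 0 c \<in> null_sets (lborel :: (real ^ 'n) measure)"
    using negligible_sphere[of "0 :: real ^ 'n" c]
    by (simp add: negligible_iff_null_sets null_sets_completion_iff)
  have "AE x :: real ^ 'n in lborel. norm x \<noteq> c"
    using AE_not_in[OF null] by simp
  then have "emeasure lborel {x. x \<noteq> 0 \<and> norm x < c \<and> x /\<^sub>R norm x \<in> A} =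
      emeasure lborel {x. x \<noteq> 0 \<and> norm x \<le> c \<and> x /\<^sub>R norm x \<in> A}"
    by (intro emeasure_eq_AE) (auto elim!: eventually_mono)
  also have "\<dots> = ennreal (c ^ CARD('n)) *
      emeasure lborel ((\<lambda>x. c *\<^sub>R x) -` {x. x \<noteq> 0 \<and> norm x \<le> c \<and> x /\<^sub>R norm x \<in> A})"
    using c by (subst emeasure_lborel_scaleR_vimage[where c = c]) auto
  also have "(\<lambda>x. c *\<^sub>R x) -` {x. x \<noteq> 0 \<and> norm x \<le> c \<and> x /\<^sub>R norm x \<in> A} =
      {x. x \<noteq> 0 \<and> norm x \<le> 1 \<and> x /\<^sub>R norm x \<in> A}"
    using c by (auto simp: field_simps)
  finally show ?thesis
    using A by (simp add: emeasure_spherical_measure mult.left_commute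
        spherical_sector_eq[OF borel_set_spherical_measure(2)[OF A]])
qed

text \<open>
  The inequality is strict because \<open>g\<^sub>i \<up> g\<close> implies \<open>\<Union>\<^sub>i {|x| < g\<^sub>i} = {|x| < g}\<close>, which
  fails for \<open>\<le>\<close>.
\<close>

definition radial_subgraph :: "(real ^ 'n \<Rightarrow> real) \<Rightarrow> (real ^ 'n) set" where
  "radial_subgraph g = {x. x \<noteq> 0 \<and> norm x < g (x /\<^sub>R norm x)}"

text \<open>The subgraph splits into finitely many sectors, one for each value \<open>y\<close> of
  \<open>g\<close>: its base is the level set of \<open>y\<close> and its radius is
  \<open>y\<close>. Distinct level sets are disjoint, so the volumes of the sectors add up to the
  integral.\<close>

lemma emeasure_radial_subgraph_simple:
  fixes g :: "real ^ 'n \<Rightarrow> real"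
  assumes g: "simple_function spherical_measure g" and nonneg: "\<And>u. g u \<ge> 0"
  shows "radial_subgraph g \<in> sets borel" (is ?sets)
    and "of_nat CARD('n) * emeasure lborel (radial_subgraph g) =
      (\<integral>\<^sup>+u. ennreal (g u ^ CARD('n)) \<partial>spherical_measure)" (is ?eq)
proof -
  let ?R = "g ` sphere 0 1"
  let ?L = "\<lambda>y. g -` {y} \<inter> sphere 0 1"
  let ?S = "\<lambda>y. {x. x \<noteq> 0 \<and> norm x < y \<and> x /\<^sub>R norm x \<in> ?L y}"
  have fin: "finite ?R" and L: "\<And>y. y \<in> ?R \<Longrightarrow> ?L y \<in> sets spherical_measure"
    using g by (auto simp: simple_function_def space_spherical_measure)
  have S: "?S y \<in> sets borel" if "y \<in> ?R" for y
  proof -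
    note [measurable] = borel_set_spherical_measure(1)[OF L[OF that]]
    show ?thesis by measurable
  qed
  have un: "radial_subgraph g = (\<Union>y\<in>?R. ?S y)"
  proof (intro equalityI subsetI)
    fix x assume "x \<in> radial_subgraph g"
    then have "x \<in> ?S (g (x /\<^sub>R norm x))" "x /\<^sub>R norm x \<in> sphere 0 1"
      by (auto simp: radial_subgraph_def)
    then show "x \<in> (\<Union>y\<in>?R. ?S y)"
      by blast
  qed (auto simp: radial_subgraph_def)
  show ?sets
    unfolding un using fin S by (intro sets.finite_UN) auto
  have "emeasure lborel (radial_subgraph g) = (\<Sum>y\<in>?R. emeasure lborel (?S y))"
    unfolding un using fin S
    by (intro sum_emeasure[symmetric]) (auto simp: disjoint_family_on_def)
  then have "of_nat CARD('n) * emeasure lborel (radial_subgraph g) =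
      (\<Sum>y\<in>?R. ennreal (y ^ CARD('n)) * emeasure spherical_measure (?L y))"
    using nonneg L by (simp only: sum_distrib_left) (rule sum.cong[OF refl emeasure_spherical_sector]; blast)
  also have "\<dots> = (\<Sum>y\<in>?R. \<integral>\<^sup>+u. ennreal (y ^ CARD('n)) * indicator (?L y) u \<partial>spherical_measure)"
    using L by (intro sum.cong refl) (simp add: nn_integral_cmult_indicator)
  also have "\<dots> = (\<integral>\<^sup>+u. (\<Sum>y\<in>?R. ennreal (y ^ CARD('n)) * indicator (?L y) u) \<partial>spherical_measure)"
    using L by (subst nn_integral_sum) auto
  also have "\<dots> = (\<integral>\<^sup>+u. ennreal (g u ^ CARD('n)) \<partial>spherical_measure)"
  proof (intro nn_integral_cong)
    fix u :: "real ^ 'n" assume "u \<in> space spherical_measure"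
    then have u: "u \<in> sphere 0 1" by (simp add: space_spherical_measure)
    have "(\<Sum>y\<in>?R. ennreal (y ^ CARD('n)) * indicator (?L y) u) =
        (\<Sum>y\<in>?R. if y = g u then ennreal (y ^ CARD('n)) else 0)"
      using u by (intro sum.cong) (auto simp: indicator_def)
    also have "\<dots> = ennreal (g u ^ CARD('n))"
      using fin u by (subst sum.delta) auto
    finally show "(\<Sum>y\<in>?R. ennreal (y ^ CARD('n)) * indicator (?L y) u) = ennreal (g u ^ CARD('n))" .
  qed
  finally show ?eq .
qed

text \<open>Along simple functions increasing to \<open>g\<close> both sides converge monotonically:
  the subgraphs increase to that of \<open>g\<close>, and so do the integrands.\<close>

lemma emeasure_radial_subgraph:
  fixes g :: "real ^ 'n \<Rightarrow> real"
  assumes g: "g \<in> borel_measurable spherical_measure" and nonneg: "\<And>u. g u \<ge> 0"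
  shows "radial_subgraph g \<in> sets borel" (is ?sets)
    and "of_nat CARD('n) * emeasure lborel (radial_subgraph g) =
      (\<integral>\<^sup>+u. ennreal (g u ^ CARD('n)) \<partial>spherical_measure)" (is ?eq)
proof -
  obtain f where f: "incseq f" "\<And>i. simple_function spherical_measure (f i)"
      "\<And>u. bdd_above (range (\<lambda>i. f i u))" "\<And>i u. 0 \<le> f i u" "g = (SUP i. f i)"
    using borel_measurable_implies_simple_function_sequence_real[OF g nonneg] by metis
  have g_SUP: "g u = (SUP i. f i u)" for u
    by (simp add: f(5) SUP_apply image_comp)
  have mono: "incseq (\<lambda>i. f i u)" for u
    using f(1) by (auto simp: incseq_def le_fun_def)
  have lim: "(\<lambda>i. f i u) \<longlonglongrightarrow> g u" for u
    unfolding g_SUP by (rule LIMSEQ_incseq_SUP[OF f(3) mono])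
  have le: "f i u \<le> g u" for i u
    by (rule incseq_le[OF mono lim])
  have un: "radial_subgraph g = (\<Union>i. radial_subgraph (f i))"
  proof (intro equalityI subsetI)
    fix x assume x: "x \<in> radial_subgraph g"
    then have "norm x < (SUP i. f i (x /\<^sub>R norm x))"
      by (simp add: radial_subgraph_def g_SUP)
    then obtain i where "norm x < f i (x /\<^sub>R norm x)"
      using f(3) by (subst (asm) less_cSUP_iff) auto
    with x show "x \<in> (\<Union>i. radial_subgraph (f i))"
      by (auto simp: radial_subgraph_def)
  next
    fix x assume "x \<in> (\<Union>i. radial_subgraph (f i))"
    then show "x \<in> radial_subgraph g"
      using le by (fastforce simp: radial_subgraph_def intro: less_le_trans)
  qed
  have sets: "radial_subgraph (f i) \<in> sets borel" for i
    using emeasure_radial_subgraph_simple(1) f by blast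
  then show ?sets
    unfolding un by auto
  have inc: "incseq (\<lambda>i. radial_subgraph (f i))"
    using mono by (fastforce simp: incseq_def radial_subgraph_def intro: less_le_trans)
  have [measurable]: "f i \<in> borel_measurable spherical_measure" for i
    using f(2) by (rule borel_measurable_simple_function)
  have "of_nat CARD('n) * emeasure lborel (radial_subgraph g) =
      (SUP i. of_nat CARD('n) * emeasure lborel (radial_subgraph (f i)))"
    unfolding un using inc sets
    by (subst SUP_emeasure_incseq[symmetric]) (auto simp: SUP_mult_left_ennreal)
  also have "\<dots> = (SUP i. \<integral>\<^sup>+u. ennreal (f i u ^ CARD('n)) \<partial>spherical_measure)"
    using f by (simp add: emeasure_radial_subgraph_simple(2))
  also have "\<dots> = (\<integral>\<^sup>+u. (SUP i. ennreal (f i u ^ CARD('n))) \<partial>spherical_measure)"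
    using mono f(4)
    by (intro nn_integral_monotone_convergence_SUP[symmetric])
      (auto simp: incseq_def le_fun_def intro!: ennreal_leI power_mono)
  \<comment> \<open>Both integrands are limits of the same sequence: the supremum because it
    increases, the power of \<open>g u\<close> because powers and \<open>ennreal\<close> are
    continuous.\<close>
  also have "\<dots> = (\<integral>\<^sup>+u. ennreal (g u ^ CARD('n)) \<partial>spherical_measure)"
  proof (intro nn_integral_cong LIMSEQ_unique)
    fix u
    show "(\<lambda>i. ennreal (f i u ^ CARD('n))) \<longlonglongrightarrow> (SUP i. ennreal (f i u ^ CARD('n)))"
      using mono f(4)
      by (intro LIMSEQ_SUP) (auto simp: incseq_def intro!: ennreal_leI power_mono)
    show "(\<lambda>i. ennreal (f i u ^ CARD('n))) \<longlonglongrightarrow> ennreal (g u ^ CARD('n))"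
      by (intro tendsto_ennrealI tendsto_power lim)
  qed
  finally show ?eq .
qed

section \<open>Finiteness and full support of the spherical measure\<close>

lemma finite_measure_spherical_measure: "finite_measure (spherical_measure :: (real ^ 'n) measure)"
proof
  have "emeasure lborel (cball 0 1 :: (real ^ 'n) set) \<noteq> \<infinity>"
    using emeasure_lborel_cball_finite[of "0 :: real ^ 'n" 1] by simp
  then show "emeasure (spherical_measure :: (real ^ 'n) measure) (space spherical_measure) \<noteq> \<infinity>"
    by (simp add: space_spherical_measure emeasure_spherical_measure_sphere ennreal_mult_eq_top_iff)
qed

lemma measure_spherical_measure_sphere:
  "measure (spherical_measure :: (real ^ 'n) measure) (sphere 0 1) =
     real CARD('n) * measure lborel (cball 0 1 :: (real ^ 'n) set)"
  unfolding measure_def emeasure_spherical_measure_sphere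
  by (simp add: enn2real_mult)

lemma integrable_spherical_measure:
  fixes g :: "real ^ 'n \<Rightarrow> real"
  assumes g: "continuous_on (sphere 0 1) g"
  shows "integrable spherical_measure g"
proof -
  have meas: "g \<in> borel_measurable spherical_measure"
    using borel_measurable_continuous_on_restrict[OF g]
    by (simp cong: measurable_cong_sets add: sets_spherical_measure)
  obtain B where "\<And>u. u \<in> sphere 0 1 \<Longrightarrow> norm (g u) \<le> B"
    using compact_imp_bounded[OF compact_continuous_image[OF g compact_sphere]]
    by (meson bounded_iff imageI)
  then show ?thesis
    using meas
    by (intro finite_measure.integrable_const_bound[OF finite_measure_spherical_measure, where B = B])
      (auto simp: space_spherical_measure)
qed

text \<open>If \<open>g u\<close> differed from \<open>c\<close>, the sector over the relatively
  open set \<open>W\<close> where \<open>g\<close> differs from \<open>c\<close> would be open and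
  contain half of \<open>u\<close>, yet have volume zero.\<close>

lemma AE_spherical_measure_continuous_eq_const:
  fixes g :: "real ^ 'n \<Rightarrow> real"
  assumes g: "continuous_on (sphere 0 1) g" and AE: "AE u in spherical_measure. g u = c"
    and u: "u \<in> sphere 0 1"
  shows "g u = c"
proof (rule ccontr)
  assume ne: "g u \<noteq> c"
  define W where "W = sphere 0 1 \<inter> g -` (- {c})"
  have "openin (top_of_set (sphere 0 1)) W"
    unfolding W_def by (rule continuous_openin_preimage_gen[OF g]) (simp add: open_Compl)
  then obtain U where U: "open U" "W = sphere 0 1 \<inter> U"
    by (auto simp: openin_open)
  have W: "W \<in> sets spherical_measure"
    using U by (auto simp: sets_spherical_measure sets_restrict_space)
  define C where "C = {x. x \<noteq> 0 \<and> norm x < 1 \<and> x /\<^sub>R norm x \<in> W}"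
  have "AE u in spherical_measure. u \<notin> W"
    using AE by (rule AE_mp) (simp add: W_def)
  then have "emeasure spherical_measure W = 0"
    using W AE_iff_null_sets by blast
  then have "emeasure lborel C = 0"
    using emeasure_spherical_sector[OF W, of 1] by (simp add: C_def)
  \<comment> \<open>With the ambient open set \<open>U\<close> in place of \<open>W\<close>,
    \<open>C\<close> is the preimage of an open set under a map that is continuous away from the
    origin.\<close>
  moreover have C_eq: "C = (ball 0 1 - {0}) \<inter> (\<lambda>x. x /\<^sub>R norm x) -` U"
    by (auto simp: C_def U(2))
  have "open C"
    unfolding C_eq using U(1) by (intro continuous_open_preimage continuous_intros) auto
  moreover have "(1/2) *\<^sub>R u \<in> C"
    using u ne by (auto simp: C_def W_def)
  ultimately have "negligible C" "open C" "C \<noteq> {}"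
    by (auto simp: negligible_iff_null_sets intro!: null_sets_completionI null_setsI)
  then show False
    using open_not_negligible by blast
qed

section \<open>Star bodies in terms of their radial functions\<close>

text \<open>\<open>GREATEST\<close> on the reals is informative only when a maximum exists. Here the
  admissible \<open>l\<close> form a compact set, since \<open>K\<close> is compact and
  \<open>u\<close> is a unit vector, and this set contains \<open>0\<close> by the segment
  condition.\<close>

lemma radial_function_greatest:
  fixes K :: "(real ^ 'n) set"
  assumes K: "compact K" "K \<noteq> {}" "\<And>x. x \<in> K \<Longrightarrow> closed_segment 0 x \<subseteq> K" and u: "norm u = 1"
  shows "radial_function K u *\<^sub>R u \<in> K"
    and "l *\<^sub>R u \<in> K \<Longrightarrow> l \<le> radial_function K u"
proof -
  let ?L = "(\<lambda>l. l *\<^sub>R u) -` K"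
  obtain b where b: "\<And>x. x \<in> K \<Longrightarrow> norm x \<le> b"
    using compact_imp_bounded[OF K(1)] by (auto simp: bounded_iff)
  have "closed ?L"
    using compact_imp_closed[OF K(1)] by (intro continuous_closed_vimage) auto
  moreover have "bounded ?L"
    unfolding bounded_iff using b u by (intro exI[of _ b]) fastforce
  ultimately have "compact ?L"
    by (simp add: compact_eq_bounded_closed)
  moreover have "0 \<in> ?L"
    using K(2,3) by auto
  ultimately obtain m where m: "m \<in> ?L" "\<And>l. l \<in> ?L \<Longrightarrow> l \<le> m"
    using compact_attains_sup[of ?L] by blast
  have "radial_function K u = m"
    unfolding radial_function_def using m by (intro Greatest_equality) auto
  with m show "radial_function K u *\<^sub>R u \<in> K" "l *\<^sub>R u \<in> K \<Longrightarrow> l \<le> radial_function K u"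
    by auto
qed

text \<open>Maximality gives one direction. For the other, \<open>x\<close> lies on the segment from
  the origin to the farthest point of \<open>K\<close> in its direction. At the origin the direction
  \<open>x /\<^sub>R norm x\<close> defaults to \<open>0\<close>, where the radial function carries
  no information, hence the separate disjunct.\<close>

lemma star_body_mem_iff:
  fixes K :: "(real ^ 'n) set"
  assumes K: "star_body K"
  shows "x \<in> K \<longleftrightarrow> x = 0 \<or> norm x \<le> radial_function K (x /\<^sub>R norm x)"
proof (cases "x = 0")
  case True
  with K show ?thesis
    by (auto simp: star_body_def)
next
  case False
  define u where "u = x /\<^sub>R norm x"
  have u: "norm u = 1" "x = norm x *\<^sub>R u"
    using False by (auto simp: u_def)
  note greatest = radial_function_greatest[OF _ _ _ u(1), of K]
  have "x \<in> K" if le: "norm x \<le> radial_function K u"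
  proof -
    let ?r = "radial_function K u"
    have r: "?r > 0"
      using K u(1) by (auto simp: star_body_def)
    have "x = (norm x / ?r) *\<^sub>R (?r *\<^sub>R u)"
      using u(2) r by simp
    then have "x \<in> closed_segment 0 (?r *\<^sub>R u)"
      using le r by (auto simp: in_segment intro!: exI[of _ "norm x / ?r"])
    moreover have "?r *\<^sub>R u \<in> K"
      using greatest(1) K by (auto simp: star_body_def)
    ultimately show ?thesis
      using K by (auto simp: star_body_def)
  qed
  moreover have "norm x \<le> radial_function K u" if "x \<in> K"
    using greatest(2)[of "norm x"] that K u(2) by (auto simp: star_body_def)
  ultimately show ?thesis
    using False by (auto simp: u_def)
qed

text \<open>Away from the origin this is where \<open>K\<close>, given by a weak inequality, differs
  from its radial subgraph, given by a strict one.\<close>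

lemma star_body_radial_boundary_null:
  fixes K :: "(real ^ 'n) set"
  assumes K: "star_body K"
  shows "(\<lambda>u. radial_function K u *\<^sub>R u) ` sphere 0 1 \<in> null_sets lborel" (is "?S \<in> _")
proof -
  have cont: "continuous_on (sphere 0 1) (radial_function K)"
    and pos: "\<And>u. norm u = 1 \<Longrightarrow> radial_function K u > 0"
    using K by (auto simp: star_body_def)
  have "compact ?S"
    by (intro compact_continuous_image compact_sphere continuous_intros cont)
  then have closed: "closed ?S"
    by (rule compact_imp_closed)
  \<comment> \<open>Every ray from the origin meets \<open>?S\<close> in exactly one point.\<close>
  have "negligible ?S"
  proof (rule starlike_negligible[OF closed, where a = 0])
    fix c x assume c: "0 \<le> c" and cx: "0 + c *\<^sub>R x \<in> ?S" and x: "0 + x \<in> ?S"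
    obtain u where u: "norm u = 1" "x = radial_function K u *\<^sub>R u"
      using x by auto
    obtain v where v: "norm v = 1" "c *\<^sub>R x = radial_function K v *\<^sub>R v"
      using cx by auto
    \<comment> \<open>Taking norms recovers the two radii. The two points then have the same
      direction, and equal directions force equal radii.\<close>
    have nx: "norm x = radial_function K u" and ncx: "c * norm x = radial_function K v"
      using u v(1) pos[OF u(1)] pos[OF v(1)] c arg_cong[OF v(2), of norm] by simp_all
    have "c > 0"
      using ncx pos[OF v(1)] c by (cases "c = 0") auto
    have "v = u"
    proof -
      have "radial_function K v *\<^sub>R v = radial_function K v *\<^sub>R u"
        using v(2) u(2) ncx nx by (metis scaleR_scaleR)
      then show ?thesis
        using pos[OF v(1)] by simp
    qed
    then show "c = 1"
      using ncx nx pos[OF u(1)] by simp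
  qed
  then show ?thesis
    using closed by (simp add: negligible_iff_null_sets null_sets_completion_iff)
qed

text \<open>\<open>K\<close> agrees with a radial subgraph off the origin and the radial boundary,
  which are null, so the polar formula for subgraphs applies.\<close>

lemma star_body_volume:
  fixes K :: "(real ^ 'n) set"
  assumes K: "star_body K"
  shows "real CARD('n) * measure lborel K = (LINT u|spherical_measure. radial_function K u ^ CARD('n))"
proof -
  let ?r = "radial_function K"
  \<comment> \<open>The formula for subgraphs asks for a function that is nonnegative everywhere,
    while the sign of \<open>?r\<close> is known only on the sphere; there \<open>max\<close>
    changes nothing.\<close>
  let ?g = "\<lambda>u. max 0 (?r u)"
  have cont: "continuous_on (sphere 0 1) ?r"
    and pos: "\<And>u. norm u = 1 \<Longrightarrow> ?r u > 0"
    using K by (auto simp: star_body_def)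
  have "?g \<in> borel_measurable spherical_measure"
    using integrable_spherical_measure[OF cont] by auto
  note subgraph = emeasure_radial_subgraph[OF this]
  have K_borel: "K \<in> sets borel"
    using K by (simp add: star_body_def borel_compact)
  have *: "x \<in> K \<longleftrightarrow> x \<in> radial_subgraph ?g"
    if x: "x \<noteq> 0" "x \<notin> (\<lambda>u. ?r u *\<^sub>R u) ` sphere 0 1" for x
  proof -
    have "norm x \<noteq> ?r (x /\<^sub>R norm x)"
    proof
      assume "norm x = ?r (x /\<^sub>R norm x)"
      then have "x = ?r (x /\<^sub>R norm x) *\<^sub>R (x /\<^sub>R norm x)"
        using x(1) by (metis divideR_right norm_eq_zero)
      then show False
        using x by (metis (mono_tags, lifting) image_eqI mem_sphere_0 norm_eq_zero norm_sgn sgn_div_norm)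
    qed
    then show ?thesis
      using x(1) by (auto simp: star_body_mem_iff[OF K] radial_subgraph_def less_max_iff_disj)
  qed
  have "AE x in lborel. x \<in> K \<longleftrightarrow> x \<in> radial_subgraph ?g"
    using AE_not_in[OF star_body_radial_boundary_null[OF K]] AE_lborel_singleton[of 0]
    by eventually_elim (use * in auto)
  then have "emeasure lborel K = emeasure lborel (radial_subgraph ?g)"
    using K_borel subgraph(1) by (intro emeasure_eq_AE) auto
  then have "of_nat CARD('n) * emeasure lborel K =
      (\<integral>\<^sup>+u. ennreal (?g u ^ CARD('n)) \<partial>spherical_measure)"
    using subgraph(2) by simp
  also have "\<dots> = (\<integral>\<^sup>+u. ennreal (?r u ^ CARD('n)) \<partial>spherical_measure)"
    using pos by (intro nn_integral_cong) (auto simp: space_spherical_measure max_def less_imp_le)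
  also have "\<dots> = ennreal (LINT u|spherical_measure. ?r u ^ CARD('n))"
    using pos cont
    by (intro nn_integral_eq_integral integrable_spherical_measure AE_I2 continuous_intros)
      (auto simp: space_spherical_measure less_imp_le)
  finally have "enn2real (of_nat CARD('n) * emeasure lborel K) =
      enn2real (ennreal (LINT u|spherical_measure. ?r u ^ CARD('n)))"
    by (rule arg_cong)
  also have "\<dots> = (LINT u|spherical_measure. ?r u ^ CARD('n))"
    using pos by (intro enn2real_ennreal integral_nonneg_AE AE_I2)
      (auto simp: space_spherical_measure less_imp_le)
  finally show ?thesis
    by (simp add: measure_def enn2real_mult)
qed

section \<open>Strict convexity and equality in Jensen's inequality\<close>

lemma strictly_convex_on_imp_convex_on:
  assumes "strictly_convex_on S f"
  shows "convex_on S f"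
proof (rule convex_onI)
  show "convex S"
    using assms by (simp add: strictly_convex_on_def)
  fix t :: real and x y assume "0 < t" "t < 1" "x \<in> S" "y \<in> S"
  then show "f ((1 - t) *\<^sub>R x + t *\<^sub>R y) \<le> (1 - t) * f x + t * f y"
    using assms unfolding strictly_convex_on_def
    by (cases "x = y") (simp add: algebra_simps, fastforce intro!: less_imp_le)
qed

text \<open>At the midpoint of \<open>x\<close> and \<open>y\<close> the function is strictly below
  the chord but not below the supporting line, so the chord, which meets the line at
  \<open>x\<close>, is strictly above it at \<open>y\<close>.\<close>

lemma strictly_convex_on_above_tangent:
  fixes f :: "real \<Rightarrow> real"
  assumes f: "strictly_convex_on S f" and x: "x \<in> S" and y: "y \<in> S" "y \<noteq> x"
    and tangent: "\<And>z. z \<in> S \<Longrightarrow> f z \<ge> f x + c * (z - x)"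
  shows "f y > f x + c * (y - x)"
proof -
  let ?z = "(1/2) *\<^sub>R x + (1/2) *\<^sub>R y"
  have "f ?z < 1/2 * f x + 1/2 * f y"
    using f x y unfolding strictly_convex_on_def
    by (metis add_divide_distrib divide_self_if half_gt_zero_iff one_add_one zero_less_one zero_neq_numeral)
  moreover have "?z \<in> S"
    using f x y unfolding strictly_convex_on_def by (intro convexD) auto
  then have "f ?z \<ge> f x + c * (?z - x)"
    by (rule tangent)
  ultimately show ?thesis
    by (simp add: field_simps)
qed

text \<open>Integrate the gap \<open>?d\<close> between \<open>F\<close> and a supporting line at
  the interior point \<open>m\<close>. The gap is nonnegative; if its integral vanishes it is zero
  almost everywhere, and strict convexity makes it positive wherever \<open>X\<close> differs from
  \<open>m\<close>.\<close>

lemma (in finite_measure) jensen_average: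
  fixes X :: "'a \<Rightarrow> real" and F :: "real \<Rightarrow> real"
  defines "T \<equiv> measure M (space M)"
  defines "m \<equiv> integral\<^sup>L M X / T"
  assumes X: "integrable M X" "\<And>x. x \<in> space M \<Longrightarrow> X x \<in> I"
    and F: "integrable M (\<lambda>x. F (X x))"
    and I: "convex_on I F" "m \<in> interior I" and T: "T > 0"
  shows "T * F m \<le> (LINT x|M. F (X x))"
    and "strictly_convex_on I F \<Longrightarrow> (LINT x|M. F (X x)) = T * F m \<Longrightarrow> AE x in M. X x = m"
proof -
  obtain c where c: "\<And>y. y \<in> I \<Longrightarrow> F y \<ge> F m + c * (y - m)"
    using convex_le_Inf_differential[OF I] by blast
  let ?d = "\<lambda>x. F (X x) - (F m + c * (X x - m))"
  have d: "integrable M ?d" "AE x in M. 0 \<le> ?d x"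
    using X F c by auto
  have "(LINT x|M. ?d x) = (LINT x|M. F (X x)) - (T * F m + c * (integral\<^sup>L M X - T * m))"
    using X(1) F by (simp add: T_def)
  \<comment> \<open>Since \<open>m\<close> is the mean of \<open>X\<close>, the linear term of the
    supporting line integrates to zero.\<close>
  also have "T * m = integral\<^sup>L M X"
    using T by (simp add: m_def)
  finally have eq: "(LINT x|M. ?d x) = (LINT x|M. F (X x)) - T * F m"
    by simp
  show "T * F m \<le> (LINT x|M. F (X x))"
    using eq integral_nonneg_AE[OF d(2)] by simp
  assume strict: "strictly_convex_on I F" and "(LINT x|M. F (X x)) = T * F m"
  then have "AE x in M. ?d x = 0"
    using integral_nonneg_eq_0_iff_AE[OF d] eq by simp
  then show "AE x in M. X x = m"
  proof (rule AE_mp, intro AE_I2 impI)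
    fix x assume x: "x \<in> space M" "?d x = 0"
    show "X x = m"
    proof (rule ccontr)
      assume "X x \<noteq> m"
      then have "F (X x) > F m + c * (X x - m)"
        using strictly_convex_on_above_tangent[OF strict _ X(2)[OF x(1)] _ c] I(2) interior_subset
        by blast
      with x show False by simp
    qed
  qed
qed

section \<open>Mean radii of balls and the volume radius\<close>

lemma radial_function_cball:
  fixes u :: "real ^ 'n"
  assumes "r > 0" "norm u = 1"
  shows "radial_function ((\<lambda>x. r *\<^sub>R x) ` cball 0 1) u = r"
  unfolding radial_function_def
  using assms by (intro Greatest_equality) (auto simp: cball_scale intro: image_eqI[of _ _ u])

lemma vrad_scaled_ball:
  assumes "r > 0"
  shows "vrad ((\<lambda>x :: real ^ 'n. r *\<^sub>R x) ` cball 0 1) = r"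
  using assms by (simp add: vrad_def cball_scale content_cball real_root_power_cancel
      less_imp_neq[OF unit_ball_vol_pos, symmetric])

lemma orlicz_mean_radius_ball:
  assumes "r > 0"
  shows "orlicz_mean_radius \<phi> ((\<lambda>x :: real ^ 'n. r *\<^sub>R x) ` cball 0 1) = \<phi> r"
proof -
  let ?B = "(\<lambda>x :: real ^ 'n. r *\<^sub>R x) ` cball 0 1"
  have "(LINT u|spherical_measure. \<phi> (radial_function ?B u)) =
      (LINT u|(spherical_measure :: (real ^ 'n) measure). \<phi> r)"
    using assms by (intro Bochner_Integration.integral_cong)
      (auto simp: space_spherical_measure radial_function_cball)
  also have "\<dots> = real CARD('n) * measure lborel (cball 0 1 :: (real ^ 'n) set) * \<phi> r"
    by (simp add: space_spherical_measure measure_spherical_measure_sphere)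
  finally show ?thesis
    by (simp add: orlicz_mean_radius_def)
qed

text \<open>Positivity holds because \<open>K\<close> contains the ball whose radius is the minimum
  of the radial function on the compact sphere. The second claim is the polar volume formula divided
  by the total mass of the sphere.\<close>

lemma vrad_star_body:
  fixes K :: "(real ^ 'n) set"
  assumes K: "star_body K"
  shows "vrad K > 0"
    and "vrad K ^ CARD('n) = (LINT u|spherical_measure. radial_function K u ^ CARD('n)) /
      measure (spherical_measure :: (real ^ 'n) measure) (sphere 0 1)"
proof -
  let ?r = "radial_function K"
  have cont: "continuous_on (sphere 0 1) ?r"
    and pos: "\<And>u. norm u = 1 \<Longrightarrow> ?r u > 0"
    using K by (auto simp: star_body_def)
  have "sphere 0 1 \<noteq> ({} :: (real ^ 'n) set)"
    by simp
  then obtain v where v: "norm v = 1" "\<And>u. norm u = 1 \<Longrightarrow> ?r v \<le> ?r u"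
    using continuous_attains_inf[OF compact_sphere _ cont] by auto
  have "cball 0 (?r v) \<subseteq> K"
  proof
    fix x :: "real ^ 'n" assume "x \<in> cball 0 (?r v)"
    then show "x \<in> K"
      using v(2)[of "x /\<^sub>R norm x"] by (cases "x = 0") (auto simp: star_body_mem_iff[OF K])
  qed
  moreover have "K \<in> fmeasurable lborel"
    using K by (intro fmeasurable_compact) (simp add: star_body_def)
  ultimately have "measure lborel (cball (0 :: real ^ 'n) (?r v)) \<le> measure lborel K"
    by (intro measure_mono_fmeasurable) auto
  moreover have "measure lborel (cball (0 :: real ^ 'n) (?r v)) > 0"
    using pos[OF v(1)] by simp
  ultimately have K_pos: "measure lborel K > 0"
    by linarith
  then show "vrad K > 0"
    by (simp add: vrad_def)
  have "vrad K ^ CARD('n) = measure lborel K / measure lborel (cball 0 1 :: (real ^ 'n) set)"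
    using K_pos by (simp add: vrad_def)
  then show "vrad K ^ CARD('n) = (LINT u|spherical_measure. ?r u ^ CARD('n)) /
      measure (spherical_measure :: (real ^ 'n) measure) (sphere 0 1)"
    by (simp add: star_body_volume[OF K, symmetric] measure_spherical_measure_sphere)
qed

section \<open>The inequality and its equality case\<close>

text \<open>This is Jensen's inequality for \<open>F\<close> and the \<open>CARD('n)\<close>-th
  power of the radial function, whose mean is \<open>vrad K ^ CARD('n)\<close>. Applied to
  \<open>\<lambda>t. - \<phi> t\<close> and \<open>\<lambda>t. - F t\<close>, it also yields the
  concave case.\<close>

lemma orlicz_mean_radius_ge_convex:
  fixes K :: "(real ^ 'n) set" and \<phi> F :: "real \<Rightarrow> real"
  assumes K: "star_body K"
    and \<phi>: "continuous_on {0<..} \<phi>"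
    and F: "\<And>t. t > 0 \<Longrightarrow> F t = \<phi> (root CARD('n) t)"
    and conv: "convex_on {0<..} F"
  shows "orlicz_mean_radius \<phi> (vrad_ball K) \<le> orlicz_mean_radius \<phi> K"
    and "strictly_convex_on {0<..} F \<Longrightarrow>
      orlicz_mean_radius \<phi> K = orlicz_mean_radius \<phi> (vrad_ball K) \<Longrightarrow> u \<in> sphere 0 1 \<Longrightarrow>
      radial_function K u = vrad K"
proof -
  let ?\<sigma> = "spherical_measure :: (real ^ 'n) measure"
  let ?r = "radial_function K"
  let ?X = "\<lambda>u. ?r u ^ CARD('n)"
  let ?T = "measure ?\<sigma> (space ?\<sigma>)"
  have cont: "continuous_on (sphere 0 1) ?r"
    and pos: "\<And>u. norm u = 1 \<Longrightarrow> ?r u > 0"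
    using K by (auto simp: star_body_def)
  have contX: "continuous_on (sphere 0 1) ?X"
    by (intro continuous_intros cont)
  have FX: "F (t ^ CARD('n)) = \<phi> t" if "t > 0" for t
    using that F by (simp add: real_root_power_cancel)
  have T: "?T = real CARD('n) * measure lborel (cball 0 1 :: (real ^ 'n) set)"
    by (simp add: space_spherical_measure measure_spherical_measure_sphere)
  then have T_pos: "?T > 0"
    by simp
  have m: "integral\<^sup>L ?\<sigma> ?X / ?T = vrad K ^ CARD('n)"
    using vrad_star_body(2)[OF K] by (simp add: space_spherical_measure)
  have "continuous_on (sphere 0 1) (\<lambda>u. \<phi> (?r u))"
    by (rule continuous_on_compose2[OF \<phi> cont]) (auto intro: pos)
  then have "integrable ?\<sigma> (\<lambda>u. \<phi> (?r u))"
    by (rule integrable_spherical_measure)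
  then have int_F: "integrable ?\<sigma> (\<lambda>u. F (?X u))"
    by (rule Bochner_Integration.integrable_cong[OF refl, THEN iffD1, rotated])
      (simp add: space_spherical_measure FX pos)
  have mean: "(LINT u|?\<sigma>. F (?X u)) = ?T * orlicz_mean_radius \<phi> K"
  proof -
    have "(LINT u|?\<sigma>. F (?X u)) = (LINT u|?\<sigma>. \<phi> (?r u))"
      by (intro Bochner_Integration.integral_cong) (auto simp: space_spherical_measure FX pos)
    then show ?thesis
      using T_pos by (simp add: orlicz_mean_radius_def T)
  qed
  have ball: "orlicz_mean_radius \<phi> (vrad_ball K) = F (vrad K ^ CARD('n))"
    using vrad_star_body(1)[OF K] by (simp add: vrad_ball_def orlicz_mean_radius_ball FX)
  \<comment> \<open>A positive volume radius puts the mean in the interior of the half-line, where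
    \<open>F\<close> has a supporting line.\<close>
  have mI: "integral\<^sup>L ?\<sigma> ?X / ?T \<in> interior {0<..}"
    using vrad_star_body(1)[OF K] by (simp add: m interior_open)
  note jensen = finite_measure.jensen_average[OF finite_measure_spherical_measure
      integrable_spherical_measure[OF contX] _ int_F conv mI T_pos, unfolded m mean]
  show "orlicz_mean_radius \<phi> (vrad_ball K) \<le> orlicz_mean_radius \<phi> K"
    using jensen(1) T_pos by (auto simp: ball space_spherical_measure pos)
  assume strict: "strictly_convex_on {0<..} F" and u: "u \<in> sphere 0 1"
    and "orlicz_mean_radius \<phi> K = orlicz_mean_radius \<phi> (vrad_ball K)"
  then have "AE u in ?\<sigma>. ?X u = vrad K ^ CARD('n)"
    using jensen(2) by (auto simp: ball space_spherical_measure pos)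
  then have "?X u = vrad K ^ CARD('n)"
    using AE_spherical_measure_continuous_eq_const[OF contX _ u] by blast
  then show "?r u = vrad K"
    using u pos[of u] vrad_star_body(1)[OF K] by (simp add: power_eq_iff_eq_base less_imp_le)
qed

text \<open>A star body is determined by its radial function through
  \<open>star_body_mem_iff\<close>.\<close>

lemma star_body_eq_ball_if_radial_function_const:
  fixes K :: "(real ^ 'n) set"
  assumes K: "star_body K" and c: "c > 0" "\<And>u. u \<in> sphere 0 1 \<Longrightarrow> radial_function K u = c"
  shows "K = (\<lambda>x. c *\<^sub>R x) ` cball 0 1"
proof -
  have "x \<in> K \<longleftrightarrow> x \<in> cball 0 c" for x
    using c(1) c(2)[of "x /\<^sub>R norm x"]
    by (cases "x = 0") (auto simp: star_body_mem_iff[OF K])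
  then have "K = cball 0 c"
    by blast
  then show ?thesis
    using c(1) by (simp add: cball_scale)
qed

lemma orlicz_mean_radius_uminus: "orlicz_mean_radius (\<lambda>t. - \<phi> t) K = - orlicz_mean_radius \<phi> K"
  by (simp add: orlicz_mean_radius_def)

theorem theorem3p6:
  fixes K :: "(real ^ 'n) set" and \<phi> F :: "real \<Rightarrow> real"
  assumes "star_body K"
    and "continuous_on {0<..} \<phi>"
    and "\<And>t. t > 0 \<Longrightarrow> \<phi> t > 0"
    and "\<And>t. t > 0 \<Longrightarrow> F t = \<phi> (root CARD('n) t)"
  shows
    "(concave_on {0<..} F \<longrightarrow>
        orlicz_mean_radius \<phi> K \<le> orlicz_mean_radius \<phi> (vrad_ball K)) \<and>
     (convex_on {0<..} F \<longrightarrow>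
        orlicz_mean_radius \<phi> K \<ge> orlicz_mean_radius \<phi> (vrad_ball K)) \<and>
     (strictly_concave_on {0<..} F \<or> strictly_convex_on {0<..} F \<longrightarrow>
        (orlicz_mean_radius \<phi> K = orlicz_mean_radius \<phi> (vrad_ball K) \<longleftrightarrow>
          origin_symmetric_ball K))"
proof -
  note K = assms(1)
  have cont_neg: "continuous_on {0<..} (\<lambda>t. - \<phi> t)"
    by (intro continuous_intros assms(2))
  have F_neg: "- F t = - \<phi> (root CARD('n) t)" if "t > 0" for t
    using assms(4) that by simp
  note convex = orlicz_mean_radius_ge_convex[OF K assms(2,4)]
  \<comment> \<open>Concavity of \<open>F\<close> is convexity of \<open>- F\<close>, and negating
    \<open>\<phi>\<close> negates both mean radii.\<close>
  note concave = orlicz_mean_radius_ge_convex[OF K cont_neg F_neg, unfolded orlicz_mean_radius_uminus]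
  have "orlicz_mean_radius \<phi> K = orlicz_mean_radius \<phi> (vrad_ball K) \<longleftrightarrow> origin_symmetric_ball K"
    if strict: "strictly_concave_on {0<..} F \<or> strictly_convex_on {0<..} F"
  proof
    assume eq: "orlicz_mean_radius \<phi> K = orlicz_mean_radius \<phi> (vrad_ball K)"
    have "radial_function K u = vrad K" if "u \<in> sphere 0 1" for u
      using strict
    proof
      assume "strictly_concave_on {0<..} F"
      then show ?thesis
        using concave(2) eq that strictly_convex_on_imp_convex_on
        by (auto simp: strictly_concave_on_def)
    next
      assume "strictly_convex_on {0<..} F"
      then show ?thesis
        using convex(2) eq that strictly_convex_on_imp_convex_on by blast
    qed
    then show "origin_symmetric_ball K"
      using star_body_eq_ball_if_radial_function_const[OF K] vrad_star_body(1)[OF K]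
      unfolding origin_symmetric_ball_def by blast
  next
    \<comment> \<open>A ball of radius \<open>r\<close> has volume radius \<open>r\<close>, so
      \<open>vrad_ball K\<close> is \<open>K\<close> itself.\<close>
    assume "origin_symmetric_ball K"
    then show "orlicz_mean_radius \<phi> K = orlicz_mean_radius \<phi> (vrad_ball K)"
      by (auto simp: origin_symmetric_ball_def vrad_ball_def vrad_scaled_ball)
  qed
  then show ?thesis
    using convex(1) concave(1) by (auto simp: concave_on_def)
qed

end
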